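(* Let $A=(a_1,\dots,a_m)'$ and $Q=(q_1,\dots,q_m)'$ be two numerical vectors with $\min(a_1,\dots,a_m)\ge0$, $\max(a_1,\dots,a_m)>0$ and $0=q_0<q_1<q_2<\dots<q_m=1$. Then for any continuous random variables $X_1,\dots,X_n$ we have $$(S^c)_\omega\stackrel{d}{=}(S_\omega)^c,$$ where $\stackrel{d}{=}$ denotes equality in distribution, $X_\omega$ denotes the step-weighted version of a continuous random variable $X$ associated with the step-weight function $\omega=\omega_{A,Q,X}$, $S^c=X_1^c+\dots+X_n^c$ is the comonotonic sum of $X_1,\dots,X_n$, $(S^c)_\omega$ is the step-weighted version of $S^c$, and $(S_\omega)^c=((X_1)_\omega)^c+\dots+((X_n)_\omega)^c$ is the comonotonic sum of the step-weighted versions $(X_1)_\omega,\dots,(X_n)_\omega$.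
   Context: A random variable $X$ is called continuous if its distribution function $F_X(x)=P(X\le x)$ is continuous on $\mathbb R$. For a distribution function $F$ and $p\in[0,1]$: $F^{-1}(p)=\inf\{x\in\mathbb R: F(x)\ge p\}$ and $F^{-1+}(p)=\sup\{x\in\mathbb R: F(x)\le p\}$, with $\inf\emptyset=+\infty$, $\sup\emptyset=-\infty$, $\inf\mathbb R=-\infty$, $\sup\mathbb R=+\infty$. A random vector $(Z_1,\dots,Z_n)$ is comonotonic if it has the same distribution as $(F_{Z_1}^{-1}(U),\dots,F_{Z_n}^{-1}(U))$ with $U$ uniform on $(0,1)$. For random variables $Y_1,\dots,Y_n$, $(Y_1^c,\dots,Y_n^c)$ denotes a comonotonic modification: a comonotonic random vector with the same marginal distributions as $(Y_1,\dots,Y_n)$; $Y_1^c+\dots+Y_n^c$ is the comonotonic sum of $Y_1,\dots,Y_n$. (A comonotonic sum of continuous random variables has a continuous distribution function, so $(S^c)_\omega$ is defined.) Step-weighting: for a continuous random variable $X$ and vectors $A,Q$ as in the claim, the step-weight function $\omega_{A,Q,X}:\mathbb R\to[0,\infty)$ is: $a_1$ for $F_X^{-1+}(q_0)\le x<F_X^{-1}(q_1)$; $a_k$ for $F_X^{-1}(q_{k-1})\le x<F_X^{-1}(q_k)$, $k=2,\dots,m-1$; $a_m$ for $F_X^{-1}(q_{m-1})\le x\le F_X^{-1}(q_m)$; and $0$ otherwise (for $m=1$ it is $a_1$ on $F_X^{-1+}(0)\le x\le F_X^{-1}(1)$, and $0$ otherwise). The step-weighted version $X_\omega$, $\omega=\omega_{A,Q,X}$,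 is a random variable with distribution function determined by $dF_{X_\omega}(x)=\frac{\omega_{A,Q,X}(x)}{E[\omega_{A,Q,X}(X)]}\,dF_X(x)$. Note that the weight function depends on the variable being weighted: each $X_i$ is weighted with $\omega_{A,Q,X_i}$ and $S^c$ with $\omega_{A,Q,S^c}$. *)

theory Defs
  imports "HOL-Probability.Probability"
begin

definition continuous_rv :: "'a measure \<Rightarrow> ('a \<Rightarrow> real) \<Rightarrow> bool" where
  "continuous_rv M X \<longleftrightarrow>
     X \<in> borel_measurable M \<and> continuous_on UNIV (cdf (distr M borel X))"

(* Both inverses are ereal-valued, so that the conventions for the infimum and the
   supremum of {} and of the whole line hold. *)

definition quantile :: "(real \<Rightarrow> real) \<Rightarrow> real \<Rightarrow> ereal" where
  "quantile F p = Inf (ereal ` {x. F x \<ge> p})"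

definition upper_quantile :: "(real \<Rightarrow> real) \<Rightarrow> real \<Rightarrow> ereal" where
  "upper_quantile F p = Sup (ereal ` {x. F x \<le> p})"

(* U is the identity on the interval (0,1) with the uniform distribution. For a distribution
   function F and 0 < u < 1 the quantile is finite, so real_of_ereal loses nothing there. *)

definition comonotonic :: "'a measure \<Rightarrow> 'i set \<Rightarrow> ('i \<Rightarrow> 'a \<Rightarrow> real) \<Rightarrow> bool" where
  "comonotonic M I Z \<longleftrightarrow>
     (\<forall>i\<in>I. Z i \<in> borel_measurable M) \<and>
     distr M (\<Pi>\<^sub>M i\<in>I. borel) (\<lambda>w. \<lambda>i\<in>I. Z i w) =
     distr (uniform_measure lborel {0<..<1}) (\<Pi>\<^sub>M i\<in>I. borel)
       (\<lambda>u. \<lambda>i\<in>I. real_of_ereal (quantile (cdf (distr M borel (Z i))) u))"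

(* The modification Yc may live on a probability space N other than that of Y. *)

definition comonotonic_modification ::
  "'i set \<Rightarrow> 'a measure \<Rightarrow> ('i \<Rightarrow> 'a \<Rightarrow> real) \<Rightarrow> 'b measure \<Rightarrow> ('i \<Rightarrow> 'b \<Rightarrow> real) \<Rightarrow> bool" where
  "comonotonic_modification I M Y N Yc \<longleftrightarrow>
     comonotonic N I Yc \<and> (\<forall>i\<in>I. distr N borel (Yc i) = distr M borel (Y i))"

(* The k-th step interval, 1 <= k <= m: the first one starts at the upper quantile, and only
   the last one is closed on the right. *)

definition step_interval :: "nat \<Rightarrow> (nat \<Rightarrow> real) \<Rightarrow> (real \<Rightarrow> real) \<Rightarrow> nat \<Rightarrow> real set" where
  "step_interval m q F k =
     {x. (if k = 1 then upper_quantile F (q 0) else quantile F (q (k - 1))) \<le> ereal x \<and>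
         (if k = m then ereal x \<le> quantile F (q k) else ereal x < quantile F (q k))}"

(* For increasing q the step intervals are disjoint, so at most one summand is nonzero. *)

definition step_weight ::
  "nat \<Rightarrow> (nat \<Rightarrow> real) \<Rightarrow> (nat \<Rightarrow> real) \<Rightarrow> (real \<Rightarrow> real) \<Rightarrow> real \<Rightarrow> real" where
  "step_weight m a q F x = (\<Sum>k = 1..m. a k * indicator (step_interval m q F k) x)"

(* Y, on N, is a step-weighted version of X, on M. The distribution of X is the
   Lebesgue-Stieltjes measure dF_X. *)

definition step_weighted_version ::
  "nat \<Rightarrow> (nat \<Rightarrow> real) \<Rightarrow> (nat \<Rightarrow> real) \<Rightarrow>
   'a measure \<Rightarrow> ('a \<Rightarrow> real) \<Rightarrow> 'b measure \<Rightarrow> ('b \<Rightarrow> real) \<Rightarrow> bool" where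
  "step_weighted_version m a q M X N Y \<longleftrightarrow>
     (let \<omega> = step_weight m a q (cdf (distr M borel X))
      in Y \<in> borel_measurable N \<and>
         distr N borel Y =
           density (distr M borel X) (\<lambda>x. ennreal (\<omega> x / (\<integral>w. \<omega> (X w) \<partial>M))))"

end

theory Submission
  imports Defs
begin

text \<open>Let \<open>U\<close> be uniform on \<open>(0,1)\<close>, let \<open>w\<close> be the step function equal to \<open>a k\<close> on
  \<open>(q (k - 1), q k)\<close>, and let \<open>\<nu>\<close> have density \<open>w / E[w(U)]\<close> with respect to \<open>U\<close>. If \<open>S\<close> is strictly
  increasing on \<open>(0,1)\<close> and \<open>F\<close> is the distribution function of \<open>S(U)\<close>, then \<open>F(S(u)) = u\<close>, so the
  step weight of \<open>S(U)\<close> at \<open>S(u)\<close> is \<open>w u\<close>, and the step-weighted version of \<open>S(U)\<close> is the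
  image of \<open>\<nu>\<close> under \<open>S\<close>. The quantile functions \<open>T i\<close> of the \<open>X i\<close> are strictly increasing by continuity,
  hence so is their sum \<open>S\<close>, and \<open>(S\<^sup>c)\<^sub>\<omega>\<close> is distributed as \<open>S(V)\<close> with \<open>V\<close> distributed as
  \<open>\<nu>\<close>. On the other side, the quantile function of the weighted \<open>X i\<close> is \<open>T i\<close> composed with the quantile
  function of \<open>\<nu>\<close>, so the comonotonic sum of the weighted variables is \<open>S(V)\<close> too.\<close>

section \<open>The uniform law on the unit interval\<close>

abbreviation unif :: "real measure" where
  "unif \<equiv> uniform_measure lborel {0<..<1}"

definition real_quantile :: "real measure \<Rightarrow> real \<Rightarrow> real" where
  "real_quantile D u = real_of_ereal (quantile (cdf D) u)"

text \<open>The intervals are open, so the value at a breakpoint is 0; the finitely many breakpoints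
  are a null set for \<open>unif\<close>.\<close>

definition unit_step :: "nat \<Rightarrow> (nat \<Rightarrow> real) \<Rightarrow> (nat \<Rightarrow> real) \<Rightarrow> real \<Rightarrow> real" where
  "unit_step m a q u = (\<Sum>k = 1..m. a k * indicator {q (k - 1)<..<q k} u)"

lemma real_distribution_unif: "real_distribution unif"
  unfolding real_distribution_def real_distribution_axioms_def
  by (auto intro!: prob_space_uniform_measure)

lemma AE_unif: "AE u in unif. 0 < u \<and> u < 1"
  by (rule AE_uniform_measureI) auto

lemma AE_unif_not_in_finite: "finite A \<Longrightarrow> AE u in unif. u \<notin> A"
  by (rule AE_uniform_measureI)
    (auto intro: eventually_mono[OF AE_not_in[OF finite_imp_null_set_lborel]])

lemma measure_unif_atMost:
  assumes "0 \<le> p" "p \<le> 1"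
  shows "measure unif {..p} = p"
proof -
  have "{0<..<1} \<inter> {..p} = (if p = 1 then {0<..<1} else {0<..p})"
    using assms by auto
  then show ?thesis
    using assms by (subst measure_uniform_measure) auto
qed

section \<open>Quantile functions of a probability law on the line\<close>

context real_distribution
begin

text \<open>Galois connection between quantile and distribution function: by right continuity,
  \<open>cdf M x < p\<close> persists slightly to the right of \<open>x\<close>, so the infimum
  exceeds \<open>x\<close>.\<close>

lemma quantile_le_iff: "quantile (cdf M) p \<le> ereal x \<longleftrightarrow> p \<le> cdf M x"
proof
  assume "p \<le> cdf M x"
  then show "quantile (cdf M) p \<le> ereal x"
    unfolding quantile_def by (intro Inf_lower) auto
next
  assume le: "quantile (cdf M) p \<le> ereal x"
  show "p \<le> cdf M x"
  proof (rule ccontr)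
    assume "\<not> p \<le> cdf M x"
    then have "eventually (\<lambda>y. cdf M y < p) (at_right x)"
      using cdf_is_right_cont[of x] by (auto simp: continuous_within intro: order_tendstoD)
    then obtain b where "x < b" and b: "\<And>y. x < y \<Longrightarrow> y < b \<Longrightarrow> cdf M y < p"
      unfolding eventually_at_right_field by blast
    then obtain y where y: "x < y" "cdf M y < p"
      using dense by blast
    have "ereal y \<le> quantile (cdf M) p"
      unfolding quantile_def
    proof (rule Inf_greatest, clarify)
      fix z assume "p \<le> cdf M z"
      then have "cdf M y < cdf M z"
        using y by simp
      then show "ereal y \<le> ereal z"
        using cdf_nondecreasing[of z y] by fastforce
    qed
    then have "ereal y \<le> ereal x"
      using le by (rule order_trans)
    with y show False
      by simp
  qed
qed

lemma ereal_real_quantile: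
  assumes "0 < p" "p < 1"
  shows "ereal (real_quantile M p) = quantile (cdf M) p"
proof -
  have "eventually (\<lambda>x. cdf M x < p) at_bot"
    using cdf_lim_at_bot assms by (auto intro: order_tendstoD)
  then obtain x where "cdf M x < p"
    by (auto simp: eventually_at_bot_linorder)
  then have 1: "\<not> quantile (cdf M) p \<le> ereal x"
    by (simp add: quantile_le_iff)
  have "eventually (\<lambda>x. cdf M x > p) at_top"
    using cdf_lim_at_top_prob assms by (auto intro: order_tendstoD)
  then obtain y where "cdf M y > p"
    by (auto simp: eventually_at_top_linorder)
  then have "quantile (cdf M) p \<le> ereal y"
    by (simp add: quantile_le_iff)
  with 1 show ?thesis
    unfolding real_quantile_def by (cases "quantile (cdf M) p") auto
qed

lemma real_quantile_le_iff:
  "0 < p \<Longrightarrow> p < 1 \<Longrightarrow> real_quantile M p \<le> x \<longleftrightarrow> p \<le> cdf M x"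
  using quantile_le_iff[of p x] ereal_real_quantile[of p] by (metis ereal_less_eq(3))

lemma upper_quantile_le:
  assumes "p < cdf M x"
  shows "upper_quantile (cdf M) p \<le> ereal x"
  unfolding upper_quantile_def
proof (rule Sup_least, clarify)
  fix y assume "cdf M y \<le> p"
  then have "cdf M y < cdf M x"
    using assms by simp
  then show "ereal y \<le> ereal x"
    using cdf_nondecreasing[of x y] by fastforce
qed

text \<open>The quantile is infinite here, and \<open>real_of_ereal\<close> sends both infinities to
  0. The level 1 is left out, since the quantile there can be finite.\<close>

lemma real_quantile_outside:
  assumes "u \<le> 0 \<or> 1 < u"
  shows "real_quantile M u = 0"
proof (cases "u \<le> 0")
  case True
  then have "quantile (cdf M) u \<le> ereal x" for x
    using cdf_nonneg[of x] by (simp add: quantile_le_iff)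
  then have "quantile (cdf M) u = -\<infinity>"
    by (rule ereal_bot)
  then show ?thesis
    by (simp add: real_quantile_def)
next
  case False
  then have "{x. u \<le> cdf M x} = {}"
    using assms cdf_bounded_prob by (fastforce dest: order_trans)
  then show ?thesis
    by (simp add: real_quantile_def quantile_def top_ereal_def)
qed

lemma real_quantile_measurable [measurable]: "real_quantile M \<in> borel_measurable borel"
proof (rule borel_measurableI_le)
  fix x
  have "{u \<in> space borel. real_quantile M u \<le> x} =
      {0<..<1} \<inter> {..cdf M x} \<union> (if 0 \<le> x then {..0} \<union> {1<..} else {})
      \<union> (if real_quantile M 1 \<le> x then {1} else {})"
    using real_quantile_le_iff[of _ x] real_quantile_outside
    by (auto simp: not_less not_le split: if_splits) (metis not_le order.order_iff_strict)+
  then show "{u \<in> space borel. real_quantile M u \<le> x} \<in> sets borel"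
    by simp
qed

text \<open>Quantile transform: by the Galois connection, the event that the quantile is at most
  \<open>x\<close> is almost surely \<open>{..cdf M x}\<close>.\<close>

lemma distr_real_quantile: "distr unif borel (real_quantile M) = M"
proof (rule cdf_unique)
  interpret U: real_distribution unif
    by (rule real_distribution_unif)
  show "real_distribution (distr unif borel (real_quantile M))"
    by (rule U.real_distribution_distr) simp
  show "real_distribution M" ..
  show "cdf (distr unif borel (real_quantile M)) = cdf M"
  proof
    fix x
    have "cdf (distr unif borel (real_quantile M)) x = measure unif {u. real_quantile M u \<le> x}"
      by (auto simp: cdf_def measure_distr vimage_def)
    also have "\<dots> = measure unif {..cdf M x}"
    proof (rule measure_eq_AE)
      show "AE u in unif. u \<in> {u. real_quantile M u \<le> x} \<longleftrightarrow> u \<in> {..cdf M x}"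
        using AE_unif by eventually_elim (simp add: real_quantile_le_iff)
    qed simp_all
    also have "\<dots> = cdf M x"
      by (rule measure_unif_atMost) (auto simp: cdf_nonneg cdf_bounded_prob)
    finally show "cdf (distr unif borel (real_quantile M)) x = cdf M x" .
  qed
qed

lemma strict_mono_on_real_quantile:
  assumes "continuous_on UNIV (cdf M)"
  shows "strict_mono_on {0<..<1} (real_quantile M)"
proof (rule strict_mono_onI)
  fix u v :: real
  assume uv: "u \<in> {0<..<1}" "v \<in> {0<..<1}" "u < v"
  \<comment> \<open>Otherwise left continuity gives a point below the quantile where
    \<open>cdf M\<close> still exceeds \<open>u\<close>, against the minimality of the
    quantile.\<close>
  have "cdf M (real_quantile M u) \<le> u"
  proof (rule ccontr)
    assume "\<not> ?thesis"
    moreover have "(cdf M \<longlongrightarrow> cdf M (real_quantile M u)) (at_left (real_quantile M u))"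
      using assms by (auto simp: continuous_on_def intro: tendsto_within_subset)
    ultimately have "eventually (\<lambda>y. u < cdf M y) (at_left (real_quantile M u))"
      by (auto intro: order_tendstoD)
    then obtain b where "b < real_quantile M u"
      and b: "\<And>y. b < y \<Longrightarrow> y < real_quantile M u \<Longrightarrow> u < cdf M y"
      unfolding eventually_at_left_field by blast
    then obtain y where "y < real_quantile M u" "u < cdf M y"
      using dense by blast
    then show False
      using real_quantile_le_iff[of u y] uv by simp
  qed
  then show "real_quantile M u < real_quantile M v"
    using real_quantile_le_iff[of v "real_quantile M u"] uv by simp
qed

text \<open>Away from the breakpoint levels, the different endpoint conventions of
  \<open>step_interval\<close> all describe the same open interval of levels, by the Galois
  connection.\<close>

lemma step_weight_cdf:
  assumes "q 0 = 0" "q m = 1" "cdf M x \<notin> q ` {0..m}"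
  shows "step_weight m a q (cdf M) x = unit_step m a q (cdf M x)"
proof -
  have "x \<in> step_interval m q (cdf M) k \<longleftrightarrow> cdf M x \<in> {q (k - 1)<..<q k}"
    if k: "k \<in> {1..m}" for k
  proof -
    have lower: "(if k = 1 then upper_quantile (cdf M) (q 0) else quantile (cdf M) (q (k - 1))) \<le> ereal x
        \<longleftrightarrow> q (k - 1) < cdf M x" (is "?A \<longleftrightarrow> _")
    proof (cases "k = 1")
      case True
      \<comment> \<open>The level \<open>q 0 = 0\<close> is excluded, so \<open>x\<close> lies at or
        above the upper quantile and both sides hold.\<close>
      have "0 < cdf M x"
        using assms cdf_nonneg[of x] by (metis atLeastAtMost_iff image_eqI le_less less_eq_nat.simps(1))
      then show ?thesis
        using True assms upper_quantile_le[of 0 x] by simp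
    next
      case False
      have "q (k - 1) \<in> q ` {0..m}"
        using k by (intro imageI) auto
      then have "q (k - 1) \<noteq> cdf M x"
        using assms by metis
      then show ?thesis
        using False by (auto simp: quantile_le_iff)
    qed
    have upper: "(if k = m then ereal x \<le> quantile (cdf M) (q k) else ereal x < quantile (cdf M) (q k))
        \<longleftrightarrow> cdf M x < q k"
    proof (cases "k = m")
      case True
      \<comment> \<open>The level \<open>q m = 1\<close> is excluded, so \<open>x\<close> lies
        strictly below the last quantile and its closed end does not matter.\<close>
      have "cdf M x < 1"
        using assms cdf_bounded_prob[of x] by (metis atLeastAtMost_iff image_eqI le_less less_eq_nat.simps(1) order_refl)
      then show ?thesis
        using True assms quantile_le_iff[of 1 x] by auto
    next
      case False
      then show ?thesis
        using quantile_le_iff[of "q k" x] by (simp add: not_le[symmetric])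
    qed
    show ?thesis
      unfolding step_interval_def mem_Collect_eq lower upper by simp
  qed
  then show ?thesis
    unfolding step_weight_def unit_step_def by (intro sum.cong) (auto simp: indicator_def)
qed

end

section \<open>Step weighting as a change of the uniform law\<close>

lemma step_weight_measurable [measurable]: "step_weight m a q F \<in> borel_measurable borel"
  unfolding step_weight_def step_interval_def by measurable

lemma unit_step_measurable [measurable]: "unit_step m a q \<in> borel_measurable borel"
  unfolding unit_step_def by measurable

text \<open>The law \<open>\<nu>\<close> of the overview. Total mass 1 is not built in; the theorem
  derives it from the weighted variables.\<close>

definition step_law :: "nat \<Rightarrow> (nat \<Rightarrow> real) \<Rightarrow> (nat \<Rightarrow> real) \<Rightarrow> real measure" where
  "step_law m a q = density unif (\<lambda>u. ennreal (unit_step m a q u / (\<integral>u. unit_step m a q u \<partial>unif)))"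

lemma sets_step_law [measurable_cong, simp]: "sets (step_law m a q) = sets borel"
  by (simp add: step_law_def)

lemma space_step_law [simp]: "space (step_law m a q) = UNIV"
  by (simp add: step_law_def)

lemma AE_step_law: "AE u in step_law m a q. 0 < u \<and> u < 1"
  unfolding step_law_def by (subst AE_density) (use AE_unif in \<open>auto elim: eventually_mono\<close>)

lemma cdf_distr_strict_mono:
  assumes [measurable]: "S \<in> borel_measurable borel"
    and mono: "strict_mono_on {0<..<1} S" and u: "0 < u" "u < 1"
  shows "cdf (distr unif borel S) (S u) = u"
proof -
  have "cdf (distr unif borel S) (S u) = measure unif {v. S v \<le> S u}"
    by (auto simp: cdf_def measure_distr vimage_def)
  also have "\<dots> = measure unif {..u}"
  proof (rule measure_eq_AE)
    show "AE v in unif. v \<in> {v. S v \<le> S u} \<longleftrightarrow> v \<in> {..u}"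
      using AE_unif by eventually_elim (simp add: strict_mono_on_less_eq[OF mono] u)
  qed simp_all
  also have "\<dots> = u"
    using u by (intro measure_unif_atMost) auto
  finally show ?thesis .
qed

text \<open>A general increasing \<open>S\<close> covers both uses: the quantile function of a
  single \<open>X i\<close>, and the sum of these functions for the comonotonic sum.\<close>

lemma step_weighted_version_distr:
  assumes S [measurable]: "S \<in> borel_measurable borel"
    and mono: "strict_mono_on {0<..<1} S"
    and q: "q 0 = 0" "q m = 1"
    and X [measurable]: "X \<in> borel_measurable M" and law: "distr M borel X = distr unif borel S"
    and Y: "step_weighted_version m a q M X N Y"
  shows "distr N borel Y = distr (step_law m a q) borel S"
proof -
  interpret U: real_distribution unif
    by (rule real_distribution_unif)
  interpret D: real_distribution "distr unif borel S"
    by (rule U.real_distribution_distr) simp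
  define \<omega> where "\<omega> = step_weight m a q (cdf (distr unif borel S))"
  have [measurable]: "\<omega> \<in> borel_measurable borel"
    by (simp add: \<omega>_def)
  \<comment> \<open>The level of \<open>S u\<close> is \<open>u\<close> itself, and almost every
    \<open>u\<close> avoids the breakpoints.\<close>
  have ae: "AE u in unif. \<omega> (S u) = unit_step m a q u"
    using AE_unif AE_unif_not_in_finite[of "q ` {0..m}", simplified]
  proof eventually_elim
    case (elim u)
    then show ?case
      using cdf_distr_strict_mono[OF S mono, of u] D.step_weight_cdf[OF q, of "S u" a]
      by (simp add: \<omega>_def)
  qed
  have "(\<integral>w. \<omega> (X w) \<partial>M) = (\<integral>x. \<omega> x \<partial>distr M borel X)"
    by (simp add: integral_distr)
  also have "\<dots> = (\<integral>u. \<omega> (S u) \<partial>unif)"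
    unfolding law by (subst integral_distr) auto
  also have "\<dots> = (\<integral>u. unit_step m a q u \<partial>unif)"
    using ae by (intro integral_cong_AE) auto
  finally have c: "(\<integral>w. \<omega> (X w) \<partial>M) = (\<integral>u. unit_step m a q u \<partial>unif)" .
  have "distr N borel Y = density (distr unif borel S)
      (\<lambda>x. ennreal (\<omega> x / (\<integral>u. unit_step m a q u \<partial>unif)))"
    using Y unfolding step_weighted_version_def Let_def law \<omega>_def[symmetric] c by blast
  also have "\<dots> = distr (density unif
      (\<lambda>u. ennreal (\<omega> (S u) / (\<integral>u. unit_step m a q u \<partial>unif)))) borel S"
    by (rule density_distr) auto
  also have "density unif (\<lambda>u. ennreal (\<omega> (S u) / (\<integral>u. unit_step m a q u \<partial>unif))) = step_law m a q"
    unfolding step_law_def by (rule density_cong) (use ae in \<open>auto elim: eventually_mono\<close>)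
  finally show ?thesis .
qed

section \<open>Comonotonic sums and quantiles of image laws\<close>

lemma comonotonic_modification_sum:
  assumes c: "comonotonic_modification I M Y N Yc" and "finite I"
    and "\<And>i. i \<in> I \<Longrightarrow> real_distribution (distr M borel (Y i))"
  shows "(\<lambda>w. \<Sum>i\<in>I. Yc i w) \<in> borel_measurable N"
    and "distr N borel (\<lambda>w. \<Sum>i\<in>I. Yc i w) =
      distr unif borel (\<lambda>u. \<Sum>i\<in>I. real_quantile (distr M borel (Y i)) u)"
proof -
  have Yc [measurable]: "\<And>i. i \<in> I \<Longrightarrow> Yc i \<in> borel_measurable N"
    using c by (auto simp: comonotonic_modification_def comonotonic_def)
  show "(\<lambda>w. \<Sum>i\<in>I. Yc i w) \<in> borel_measurable N"
    by measurable
  let ?T = "\<lambda>i. real_quantile (distr M borel (Y i))"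
  have T [measurable]: "\<And>i. i \<in> I \<Longrightarrow> ?T i \<in> borel_measurable borel"
    by (intro real_distribution.real_quantile_measurable assms)
  \<comment> \<open>Equal marginals allow the quantile functions of \<open>Y i\<close> in place of
    those of \<open>Yc i\<close>.\<close>
  have law: "distr N (\<Pi>\<^sub>M i\<in>I. borel) (\<lambda>w. \<lambda>i\<in>I. Yc i w) =
      distr unif (\<Pi>\<^sub>M i\<in>I. borel) (\<lambda>u. \<lambda>i\<in>I. ?T i u)"
    using c by (simp add: comonotonic_modification_def comonotonic_def real_quantile_def cong: restrict_cong)
  have sum [measurable]: "(\<lambda>f. \<Sum>i\<in>I. f i) \<in> borel_measurable (\<Pi>\<^sub>M i\<in>I. borel :: real measure)"
    by measurable
  have "distr N borel (\<lambda>w. \<Sum>i\<in>I. Yc i w) =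
      distr (distr N (\<Pi>\<^sub>M i\<in>I. borel) (\<lambda>w. \<lambda>i\<in>I. Yc i w)) borel (\<lambda>f. \<Sum>i\<in>I. f i)"
    by (subst distr_distr) (auto simp: comp_def)
  also have "\<dots> = distr unif borel (\<lambda>u. \<Sum>i\<in>I. ?T i u)"
    unfolding law by (subst distr_distr) (auto simp: comp_def)
  finally show "distr N borel (\<lambda>w. \<Sum>i\<in>I. Yc i w) = distr unif borel (\<lambda>u. \<Sum>i\<in>I. ?T i u)" .
qed

text \<open>The image law has distribution function \<open>cdf \<nu>\<close> after
  \<open>cdf D\<close>; two Galois connections invert this composition. The bounds on
  \<open>real_quantile \<nu> u\<close> make the one for \<open>D\<close> applicable.\<close>

lemma real_quantile_distr:
  assumes "real_distribution D" and \<nu>: "real_distribution \<nu>"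
    and ae: "AE v in \<nu>. 0 < v \<and> v < 1"
    and u: "0 < u" "u < 1" and v: "0 < real_quantile \<nu> u" "real_quantile \<nu> u < 1"
  shows "real_quantile (distr \<nu> borel (real_quantile D)) u = real_quantile D (real_quantile \<nu> u)"
proof -
  interpret D: real_distribution D by fact
  interpret \<nu>: real_distribution \<nu> by fact
  interpret H: real_distribution "distr \<nu> borel (real_quantile D)"
    by (rule \<nu>.real_distribution_distr) simp
  have cdf: "cdf (distr \<nu> borel (real_quantile D)) x = cdf \<nu> (cdf D x)" for x
  proof -
    have "cdf (distr \<nu> borel (real_quantile D)) x = measure \<nu> {v. real_quantile D v \<le> x}"
      by (auto simp: cdf_def measure_distr vimage_def)
    also have "\<dots> = measure \<nu> {..cdf D x}"
    proof (rule measure_eq_AE)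
      show "AE v in \<nu>. v \<in> {v. real_quantile D v \<le> x} \<longleftrightarrow> v \<in> {..cdf D x}"
        using ae by eventually_elim (simp add: D.real_quantile_le_iff)
    qed simp_all
    finally show ?thesis
      by (simp add: cdf_def)
  qed
  have "real_quantile (distr \<nu> borel (real_quantile D)) u \<le> x \<longleftrightarrow>
      real_quantile D (real_quantile \<nu> u) \<le> x" for x
    using u v by (simp add: H.real_quantile_le_iff D.real_quantile_le_iff \<nu>.real_quantile_le_iff cdf)
  then show ?thesis
    by (meson order_antisym order_refl)
qed

section \<open>Both sums as images of \<open>step_law m a q\<close> under one increasing
  function\<close>

theorem theorem5p1:
  fixes m n :: nat and a q :: "nat \<Rightarrow> real"
    and M :: "'a measure" and X :: "nat \<Rightarrow> 'a \<Rightarrow> real"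
    and Mc :: "'b measure" and Xc :: "nat \<Rightarrow> 'b \<Rightarrow> real"
    and K :: "'c measure" and Sc_w :: "'c \<Rightarrow> real"
    and L :: "'d measure" and Xw :: "nat \<Rightarrow> 'd \<Rightarrow> real"
    and Lc :: "'e measure" and Xwc :: "nat \<Rightarrow> 'e \<Rightarrow> real"
  assumes "m \<ge> 1" and "n \<ge> 1"
    and "Min (a ` {1..m}) \<ge> 0" and "Max (a ` {1..m}) > 0"
    and "q 0 = 0" and "strict_mono_on {0..m} q" and "q m = 1"
    and "prob_space M" and "prob_space Mc" and "prob_space K"
    and "prob_space L" and "prob_space Lc"
    and "\<And>i. i \<in> {1..n} \<Longrightarrow> continuous_rv M (X i)"
    and "comonotonic_modification {1..n} M X Mc Xc"
    and "step_weighted_version m a q Mc (\<lambda>w. \<Sum>i = 1..n. Xc i w) K Sc_w"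
    and "\<And>i. i \<in> {1..n} \<Longrightarrow> step_weighted_version m a q M (X i) L (Xw i)"
    and "comonotonic_modification {1..n} L Xw Lc Xwc"
  shows "distr K borel Sc_w = distr Lc borel (\<lambda>w. \<Sum>i = 1..n. Xwc i w)"
proof -
  note q = \<open>q 0 = 0\<close> \<open>q m = 1\<close>
  note X = assms(13) and Xw = assms(16)
  define T where "T i = real_quantile (distr M borel (X i))" for i
  define S where "S u = (\<Sum>i = 1..n. T i u)" for u
  let ?\<nu> = "step_law m a q"
  interpret M: prob_space M by fact
  interpret L: prob_space L by fact
  have X_meas: "X i \<in> borel_measurable M" if "i \<in> {1..n}" for i
    using X[OF that] by (simp add: continuous_rv_def)
  have X_rd: "real_distribution (distr M borel (X i))" if "i \<in> {1..n}" for i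
    using X_meas[OF that] by simp
  have Xw_rd: "real_distribution (distr L borel (Xw i))" if "i \<in> {1..n}" for i
  proof -
    have "Xw i \<in> borel_measurable L"
      using Xw[OF that] by (simp add: step_weighted_version_def Let_def)
    then show ?thesis
      by simp
  qed
  have T_meas [measurable]: "T i \<in> borel_measurable borel" if "i \<in> {1..n}" for i
    unfolding T_def using X_rd[OF that] by (rule real_distribution.real_quantile_measurable)
  have S_meas [measurable]: "S \<in> borel_measurable borel"
    unfolding S_def[abs_def] by measurable
  have T_mono: "strict_mono_on {0<..<1} (T i)" if "i \<in> {1..n}" for i
    unfolding T_def using X_rd[OF that] X[OF that]
    by (auto simp: continuous_rv_def intro: real_distribution.strict_mono_on_real_quantile)
  have S_mono: "strict_mono_on {0<..<1} S"
  proof (rule strict_mono_onI)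
    fix u v :: real assume "u \<in> {0<..<1}" "v \<in> {0<..<1}" "u < v"
    then show "S u < S v"
      unfolding S_def using \<open>n \<ge> 1\<close> by (intro sum_strict_mono strict_mono_onD[OF T_mono]) auto
  qed
  have law_Xw: "distr L borel (Xw i) = distr ?\<nu> borel (T i)" if i: "i \<in> {1..n}" for i
    using T_meas[OF i] T_mono[OF i] q X_meas[OF i] _ Xw[OF i]
    by (rule step_weighted_version_distr)
      (simp add: T_def real_distribution.distr_real_quantile[OF X_rd[OF i]])
  note sum_Xc = comonotonic_modification_sum[OF assms(14) finite_atLeastAtMost X_rd]
  have "distr K borel Sc_w = distr ?\<nu> borel S"
    using S_meas S_mono q sum_Xc(1) sum_Xc(2)[folded T_def, folded S_def] assms(15)
    by (rule step_weighted_version_distr)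
  moreover have "distr Lc borel (\<lambda>w. \<Sum>i = 1..n. Xwc i w) = distr ?\<nu> borel S"
  proof -
    have 1: "1 \<in> {1..n}"
      using \<open>n \<ge> 1\<close> by simp
    \<comment> \<open>This image is the law of \<open>Xw 1\<close>, and taking images preserves
      total mass, so \<open>step_law m a q\<close> is itself a probability measure.\<close>
    have "prob_space (distr ?\<nu> borel (T 1))"
      using Xw_rd[OF 1] unfolding law_Xw[OF 1] by (simp add: real_distribution_def)
    then have "prob_space ?\<nu>"
      by (rule prob_space_distrD[rotated]) (use T_meas[OF 1] in simp)
    then have \<nu>: "real_distribution ?\<nu>"
      by (simp add: real_distribution_def real_distribution_axioms_def)
    have [measurable]: "real_quantile ?\<nu> \<in> borel_measurable borel"
      using \<nu> by (rule real_distribution.real_quantile_measurable)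
    \<comment> \<open>The quantile function of \<open>step_law m a q\<close> transports
      \<open>unif\<close> to that law, which lives on \<open>(0,1)\<close>; so its values lie there
      almost surely, as \<open>real_quantile_distr\<close> requires.\<close>
    have "AE v in distr unif borel (real_quantile ?\<nu>). 0 < v \<and> v < 1"
      unfolding real_distribution.distr_real_quantile[OF \<nu>] by (rule AE_step_law)
    then have ae: "AE u in unif. 0 < real_quantile ?\<nu> u \<and> real_quantile ?\<nu> u < 1"
      by (subst (asm) AE_distr_iff) auto
    have Xw_meas [measurable]: "real_quantile (distr L borel (Xw i)) \<in> borel_measurable borel"
      if "i \<in> {1..n}" for i
      using Xw_rd[OF that] by (rule real_distribution.real_quantile_measurable)
    have "distr Lc borel (\<lambda>w. \<Sum>i = 1..n. Xwc i w) =
        distr unif borel (\<lambda>u. \<Sum>i = 1..n. real_quantile (distr L borel (Xw i)) u)"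
      using assms(17) _ Xw_rd by (rule comonotonic_modification_sum(2)) auto
    also have "\<dots> = distr unif borel (\<lambda>u. S (real_quantile ?\<nu> u))"
    proof (rule distr_cong_AE)
      show "AE u in unif. (\<Sum>i = 1..n. real_quantile (distr L borel (Xw i)) u) = S (real_quantile ?\<nu> u)"
        using AE_unif ae
      proof eventually_elim
        case (elim u)
        have "real_quantile (distr L borel (Xw i)) u = T i (real_quantile ?\<nu> u)" if "i \<in> {1..n}" for i
          unfolding law_Xw[OF that] unfolding T_def
          using X_rd[OF that] \<nu> AE_step_law by (rule real_quantile_distr) (use elim in auto)
        then show ?case
          by (simp add: S_def)
      qed
    qed auto
    also have "\<dots> = distr (distr unif borel (real_quantile ?\<nu>)) borel S"
      by (subst distr_distr) (auto simp: comp_def)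
    also have "\<dots> = distr ?\<nu> borel S"
      by (simp add: real_distribution.distr_real_quantile[OF \<nu>])
    finally show ?thesis .
  qed
  ultimately show ?thesis
    by simp
qed

end
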